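(* Let $L$ be a complete modular lattice and let $F,G\in\mathrm{Fil}\,L$ with $F\prec G$. If the filter covering $F\prec G$ is anomalous, then $F\prec G$ is not upper regular (in $\mathrm{Fil}\,L$).
   Context: A covering $x\prec y$ in a lattice is a pair $x<y$ with no element strictly between. For pairs with $x\le y$, $z\le w$, write $\langle x,y\rangle\nearrow\langle z,w\rangle$ if $y\wedge z=x$ and $y\vee z=w$; projective equivalence $\sim$ is the symmetric and transitive closure of $\nearrow$. A covering $x\prec y$ in a complete modular lattice is upper regular if for every nonempty chain $I$ and every family of coverings $x_i\prec y_i$ ($i\in I$), each projectively equivalent to $x\prec y$ and such that $i<j$ implies $\langle x_i,y_i\rangle\nearrow\langle x_j,y_j\rangle$, we have $\bigvee_i x_i\prec\bigvee_i y_i$. A filter of $L$ is a nonempty up-closed subset closed under binary meets. $\mathrm{Fil}\,L$ is the lattice of filters ordered by reverse inclusion ($F\le G$ iff $G\subseteq F$), with $F\vee G=F\cap G$; it is complete and modular when $L$ is. $\mathrm{Fg}\{x\}=\{z\in L: z\ge x\}$; filters of this form are principal. A filter covering is a covering in $\mathrm{Fil}\,L$. A maximal based filter is a pair $\langle x,H\rangle$ with $x\in L$, $H\in\mathrm{Fil}\,L$ and $\mathrm{Fg}\{x\}\prec H$. It is atomic if $H$ is principal. It is quasi-atomic if $H$ is not principal but contains an element $y$ such that $x<z\le y$ implies $z\in H$. A filter covering $F\prec G$ is atomic (resp. quasi-atomic) if it is projectively equivalent in $\mathrm{Fil}\,L$ to $\mathrm{Fg}\{x\}\prec H$ for some atomic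 (resp. quasi-atomic) maximal based filter $\langle x,H\rangle$. A maximal based filter or filter covering is anomalous if it is neither atomic nor quasi-atomic. *)

theory Defs
  imports Main
begin

class modular_lattice = lattice +
  assumes modular: "x \<le> z \<Longrightarrow> sup x (inf y z) = inf (sup x y) z"

class complete_modular_lattice = complete_lattice + modular_lattice

definition covered_by :: "'a::order \<Rightarrow> 'a \<Rightarrow> bool"  (infix "\<prec>" 50) where
  "x \<prec> y \<longleftrightarrow> x < y \<and> \<not> (\<exists>z. x < z \<and> z < y)"

definition transposes_up :: "'a::lattice \<times> 'a \<Rightarrow> 'a \<times> 'a \<Rightarrow> bool"  (infix "\<nearrow>" 50) where
  "p \<nearrow> q \<longleftrightarrow> (case (p, q) of ((x, y), (z, w)) \<Rightarrow>
     x \<le> y \<and> z \<le> w \<and> inf y z = x \<and> sup y z = w)"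

definition projective :: "'a::lattice \<times> 'a \<Rightarrow> 'a \<times> 'a \<Rightarrow> bool"  (infix "\<approx>" 50) where
  "projective = (symclp transposes_up)\<^sup>+\<^sup>+"

text \<open>
  The chain is a linearly ordered set \<open>(I, r)\<close>, with \<open>i < j\<close> read as
  \<open>(i, j) \<in> r \<and> i \<noteq> j\<close>.  A definition cannot quantify over the type of indices, so these are
  taken from \<open>'a \<times> 'a\<close>.  This is no restriction, because a family of the kind considered can be
  reindexed by its own range; see \<open>upper_regularD\<close> below.
\<close>

definition upper_regular :: "'a::complete_modular_lattice \<Rightarrow> 'a \<Rightarrow> bool" where
  "upper_regular x y \<longleftrightarrow>
     (\<forall>(I :: ('a \<times> 'a) set) r (u :: 'a \<times> 'a \<Rightarrow> 'a) (v :: 'a \<times> 'a \<Rightarrow> 'a).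
        I \<noteq> {} \<and> linear_order_on I r \<and>
        (\<forall>i\<in>I. u i \<prec> v i \<and> (u i, v i) \<approx> (x, y)) \<and>
        (\<forall>i\<in>I. \<forall>j\<in>I. (i, j) \<in> r \<and> i \<noteq> j \<longrightarrow> (u i, v i) \<nearrow> (u j, v j)) \<longrightarrow>
        (SUP i\<in>I. u i) \<prec> (SUP i\<in>I. v i))"

lemma transposes_up_refl: "x \<le> y \<Longrightarrow> (x, y) \<nearrow> (x, y)"
  by (simp add: transposes_up_def inf_absorb2 sup_absorb1)

lemma transposes_up_antisym: "p \<nearrow> q \<Longrightarrow> q \<nearrow> p \<Longrightarrow> p = q"
  by (cases p; cases q) (simp add: transposes_up_def, metis inf_le2 sup_ge1 order.antisym)

lemma transposes_up_trans:
  assumes "p \<nearrow> q" "q \<nearrow> s"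
  shows "p \<nearrow> s"
proof -
  obtain a b c d e f where p: "p = (a, b)" and q: "q = (c, d)" and s: "s = (e, f)"
    by (metis surj_pair)
  have 1: "a \<le> b" "e \<le> f" "inf b c = a" "sup b c = d" "inf d e = c" "sup d e = f"
    using assms by (auto simp: transposes_up_def p q s)
  have "b \<le> d" "c \<le> e" using 1 by (metis sup_ge1, metis inf_le2)
  have "inf b e = inf b (inf d e)"
    using \<open>b \<le> d\<close> by (simp add: inf_assoc[symmetric] inf_absorb1)
  moreover have "sup b e = sup (sup b c) e"
    using \<open>c \<le> e\<close> by (simp add: sup_assoc sup_absorb2)
  ultimately show ?thesis using 1 by (simp add: transposes_up_def p s)
qed

lemma upper_regularD:
  fixes x y :: "'a::complete_modular_lattice" and I :: "'i set" and u v :: "'i \<Rightarrow> 'a"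
  assumes reg: "upper_regular x y"
    and I: "I \<noteq> {}" "linear_order_on I r"
    and cov: "\<And>i. i \<in> I \<Longrightarrow> u i \<prec> v i \<and> (u i, v i) \<approx> (x, y)"
    and up: "\<And>i j. i \<in> I \<Longrightarrow> j \<in> I \<Longrightarrow> (i, j) \<in> r \<Longrightarrow> i \<noteq> j \<Longrightarrow> (u i, v i) \<nearrow> (u j, v j)"
  shows "(SUP i\<in>I. u i) \<prec> (SUP i\<in>I. v i)"
proof -
  let ?J = "(\<lambda>i. (u i, v i)) ` I"
  let ?s = "{(p, q). p \<in> ?J \<and> q \<in> ?J \<and> p \<nearrow> q}"
  have rfl: "p \<nearrow> p" if "p \<in> ?J" for p
    using that cov by (force simp: covered_by_def intro!: transposes_up_refl)
  have tot: "p \<nearrow> q \<or> q \<nearrow> p" if pq: "p \<in> ?J" "q \<in> ?J" for p q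
  proof -
    obtain i j where ij: "i \<in> I" "j \<in> I" "p = (u i, v i)" "q = (u j, v j)" using pq by auto
    have "i = j \<or> (i, j) \<in> r \<or> (j, i) \<in> r"
      using I(2) ij(1,2) by (auto simp: linear_order_on_def total_on_def)
    then show ?thesis
      using up[OF ij(1,2)] up[OF ij(2,1)] rfl[OF pq(1)] ij(3,4) by blast
  qed
  have "linear_order_on ?J ?s"
    unfolding linear_order_on_def partial_order_on_def preorder_on_def
  proof (intro conjI)
    show "?s \<subseteq> ?J \<times> ?J" by auto
    show "refl_on ?J ?s" using rfl by (auto simp: refl_on_def)
    show "trans ?s" by (auto simp: trans_def intro: transposes_up_trans)
    show "antisym ?s" by (auto simp: antisym_def dest: transposes_up_antisym)
    show "total_on ?J ?s" using tot by (auto simp: total_on_def)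
  qed
  moreover have "\<forall>p\<in>?J. fst p \<prec> snd p \<and> (fst p, snd p) \<approx> (x, y)" using cov by auto
  moreover have "\<forall>p\<in>?J. \<forall>q\<in>?J. (p, q) \<in> ?s \<and> p \<noteq> q \<longrightarrow> (fst p, snd p) \<nearrow> (fst q, snd q)"
    by simp
  moreover have "?J \<noteq> {}" using I(1) by simp
  ultimately have "(SUP p\<in>?J. fst p) \<prec> (SUP p\<in>?J. snd p)"
    using reg[unfolded upper_regular_def, THEN spec[of _ ?J], THEN spec[of _ ?s],
        THEN spec[of _ fst], THEN spec[of _ snd]] by blast
  then show ?thesis by (simp add: image_image)
qed

definition lattice_filter :: "'a::lattice set \<Rightarrow> bool" where
  "lattice_filter F \<longleftrightarrow> F \<noteq> {} \<and> (\<forall>x\<in>F. \<forall>y. x \<le> y \<longrightarrow> y \<in> F) \<and>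
     (\<forall>x\<in>F. \<forall>y\<in>F. inf x y \<in> F)"

lemma lattice_filterI:
  assumes "x \<in> F" "\<And>x y. x \<in> F \<Longrightarrow> x \<le> y \<Longrightarrow> y \<in> F" "\<And>x y. x \<in> F \<Longrightarrow> y \<in> F \<Longrightarrow> inf x y \<in> F"
  shows "lattice_filter F"
  using assms unfolding lattice_filter_def by (intro conjI ballI allI impI) auto

lemma lattice_filter_ex: "lattice_filter F \<Longrightarrow> \<exists>x. x \<in> F"
  unfolding lattice_filter_def ex_in_conv by (elim conjE)

lemma lattice_filter_up: "lattice_filter F \<Longrightarrow> x \<in> F \<Longrightarrow> x \<le> y \<Longrightarrow> y \<in> F"
  unfolding lattice_filter_def by (elim conjE) (drule bspec, assumption, simp)

lemma lattice_filter_inf: "lattice_filter F \<Longrightarrow> x \<in> F \<Longrightarrow> y \<in> F \<Longrightarrow> inf x y \<in> F"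
  unfolding lattice_filter_def by (elim conjE) simp

typedef (overloaded) 'a fil = "{F :: 'a::lattice set. lattice_filter F}"
  morphisms elems Abs_fil
  by (rule exI[of _ UNIV]) (simp add: lattice_filter_def)

setup_lifting type_definition_fil

instantiation fil :: (lattice) lattice
begin

lift_definition less_eq_fil :: "'a fil \<Rightarrow> 'a fil \<Rightarrow> bool" is "\<lambda>F G. G \<subseteq> F" .

definition less_fil :: "'a fil \<Rightarrow> 'a fil \<Rightarrow> bool" where
  "less_fil F G \<longleftrightarrow> F \<le> G \<and> \<not> G \<le> F"

lift_definition sup_fil :: "'a fil \<Rightarrow> 'a fil \<Rightarrow> 'a fil" is "\<lambda>F G. F \<inter> G"
proof -
  fix F G :: "'a set"
  assume F: "lattice_filter F" and G: "lattice_filter G"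
  obtain f g where "f \<in> F" "g \<in> G" using lattice_filter_ex F G by metis
  then have "sup f g \<in> F \<inter> G" using F G by (simp add: lattice_filter_up)
  then show "lattice_filter (F \<inter> G)"
    by (rule lattice_filterI) (use F G in \<open>auto intro: lattice_filter_up lattice_filter_inf\<close>)
qed

lift_definition inf_fil :: "'a fil \<Rightarrow> 'a fil \<Rightarrow> 'a fil"
  is "\<lambda>F G. {z. \<exists>f\<in>F. \<exists>g\<in>G. inf f g \<le> z}"
proof -
  fix F G :: "'a set"
  assume F: "lattice_filter F" and G: "lattice_filter G"
  let ?H = "{z. \<exists>f\<in>F. \<exists>g\<in>G. inf f g \<le> z}"
  obtain f g where "f \<in> F" "g \<in> G" using lattice_filter_ex F G by metis
  then have "inf f g \<in> ?H" by blast
  then show "lattice_filter ?H"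
  proof (rule lattice_filterI)
    fix x y assume "x \<in> ?H" "x \<le> y"
    then show "y \<in> ?H" by (blast intro: order_trans)
  next
    fix x y assume "x \<in> ?H" "y \<in> ?H"
    then obtain f g f' g' where
      *: "f \<in> F" "g \<in> G" "inf f g \<le> x" "f' \<in> F" "g' \<in> G" "inf f' g' \<le> y"
      by blast
    have "inf (inf f f') (inf g g') = inf (inf f g) (inf f' g')"
      by (simp add: inf_assoc inf_left_commute)
    also have "\<dots> \<le> inf x y" using *(3,6) by (rule inf_mono)
    finally show "inf x y \<in> ?H"
      using lattice_filter_inf[OF F *(1,4)] lattice_filter_inf[OF G *(2,5)] by blast
  qed
qed

instance
proof
  fix F G H :: "'a fil"
  show "(F < G) = (F \<le> G \<and> \<not> G \<le> F)" by (rule less_fil_def)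
  show "F \<le> F" by transfer simp
  show "F \<le> G \<Longrightarrow> G \<le> H \<Longrightarrow> F \<le> H" by transfer (rule subset_trans)
  show "F \<le> G \<Longrightarrow> G \<le> F \<Longrightarrow> F = G" by transfer (rule equalityI)
  show "inf F G \<le> F"
  proof (transfer, rule subsetI)
    fix F G :: "'a set" and x assume "lattice_filter G" "x \<in> F"
    moreover obtain g where "g \<in> G" using lattice_filter_ex calculation(1) by metis
    ultimately show "x \<in> {z. \<exists>f\<in>F. \<exists>g\<in>G. inf f g \<le> z}" using inf_le1 by blast
  qed
  show "inf F G \<le> G"
  proof (transfer, rule subsetI)
    fix F G :: "'a set" and x assume "lattice_filter F" "x \<in> G"
    moreover obtain f where "f \<in> F" using lattice_filter_ex calculation(1) by metis
    ultimately show "x \<in> {z. \<exists>f\<in>F. \<exists>g\<in>G. inf f g \<le> z}" using inf_le2 by blast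
  qed
  show "F \<le> G \<Longrightarrow> F \<le> H \<Longrightarrow> F \<le> inf G H"
  proof (transfer, rule subsetI)
    fix F G H :: "'a set" and x
    assume F: "lattice_filter F" and sub: "G \<subseteq> F" "H \<subseteq> F"
      and "x \<in> {z. \<exists>g\<in>G. \<exists>h\<in>H. inf g h \<le> z}"
    then obtain g h where "g \<in> F" "h \<in> F" "inf g h \<le> x" by blast
    then show "x \<in> F" using lattice_filter_up[OF F lattice_filter_inf[OF F]] by blast
  qed
  show "F \<le> sup F G" by transfer simp
  show "G \<le> sup F G" by transfer simp
  show "G \<le> F \<Longrightarrow> H \<le> F \<Longrightarrow> sup G H \<le> F" by transfer simp
qed

end

text \<open>
  In the reverse inclusion order joins are intersections, the empty join being the filter of all
  elements, and a meet is the join of all lower bounds, i.e. the filter generated by the union.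
\<close>

instantiation fil :: (complete_lattice) complete_lattice
begin

lift_definition Sup_fil :: "'a fil set \<Rightarrow> 'a fil" is "\<lambda>\<F>. \<Inter>\<F>"
proof -
  fix \<F> :: "'a set set"
  assume *: "\<And>F. F \<in> \<F> \<Longrightarrow> lattice_filter F"
  have "top \<in> F" if "F \<in> \<F>" for F
    using lattice_filter_ex[OF *[OF that]] lattice_filter_up[OF *[OF that]] top_greatest by metis
  then have "top \<in> \<Inter>\<F>" by blast
  then show "lattice_filter (\<Inter>\<F>)"
    by (rule lattice_filterI) (use * in \<open>auto intro: lattice_filter_up lattice_filter_inf\<close>)
qed

definition Inf_fil :: "'a fil set \<Rightarrow> 'a fil" where
  "Inf_fil \<F> = Sup {G. \<forall>F\<in>\<F>. G \<le> F}"

definition bot_fil :: "'a fil" where "bot_fil = Sup {}"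

definition top_fil :: "'a fil" where "top_fil = Inf {}"

instance
proof
  have up: "F \<le> Sup \<F>" if "F \<in> \<F>" for F :: "'a fil" and \<F>
    using that by transfer blast
  have least: "Sup \<F> \<le> G" if "\<And>F. F \<in> \<F> \<Longrightarrow> F \<le> G" for G :: "'a fil" and \<F>
    using that by transfer blast
  fix F :: "'a fil" and \<F> :: "'a fil set"
  show "F \<in> \<F> \<Longrightarrow> F \<le> Sup \<F>" by (rule up)
  show "(\<And>G. G \<in> \<F> \<Longrightarrow> G \<le> F) \<Longrightarrow> Sup \<F> \<le> F" by (rule least)
  show "F \<in> \<F> \<Longrightarrow> Inf \<F> \<le> F" unfolding Inf_fil_def by (rule least) auto
  show "(\<And>G. G \<in> \<F> \<Longrightarrow> F \<le> G) \<Longrightarrow> F \<le> Inf \<F>" unfolding Inf_fil_def by (rule up) auto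
qed (simp_all add: bot_fil_def top_fil_def)

end

instance fil :: (modular_lattice) modular_lattice
proof
  fix F G H :: "'a fil"
  assume le: "F \<le> H"
  have "inf (sup F G) H \<le> sup F (inf G H)"
    using le
  proof (transfer, intro subsetI)
    fix F G H :: "'a set" and z
    assume F: "lattice_filter F" and G: "lattice_filter G"
      and HF: "H \<subseteq> F" and z: "z \<in> F \<inter> {z. \<exists>g\<in>G. \<exists>h\<in>H. inf g h \<le> z}"
    obtain g h where gh: "g \<in> G" "h \<in> H" "inf g h \<le> z" using z by auto
    let ?a = "sup (inf z h) g"
    have "inf z h \<in> F" using HF z gh(2) by (intro lattice_filter_inf[OF F]) auto
    then have "?a \<in> F \<inter> G" using gh(1)
      by (auto intro: lattice_filter_up[OF F _ sup_ge1] lattice_filter_up[OF G _ sup_ge2])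
    moreover have "inf ?a h = sup (inf z h) (inf g h)"
      by (simp add: modular)
    then have "inf ?a h \<le> z" using gh(3) by (simp add: le_infI1)
    ultimately show "z \<in> {z. \<exists>f\<in>F \<inter> G. \<exists>g\<in>H. inf f g \<le> z}" using gh(2) by blast
  qed
  then show "sup F (inf G H) = inf (sup F G) H"
    using le by (intro antisym) (auto intro: le_infI1 le_infI2)
qed

instance fil :: (complete_modular_lattice) complete_modular_lattice ..

lift_definition Fg :: "'a::lattice \<Rightarrow> 'a fil" is "\<lambda>x. {z. x \<le> z}"
proof -
  fix x :: 'a
  have "x \<in> {z. x \<le> z}" by simp
  then show "lattice_filter {z. x \<le> z}"
    by (rule lattice_filterI) (auto intro: order_trans)
qed

definition principal_fil :: "'a::lattice fil \<Rightarrow> bool" where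
  "principal_fil H \<longleftrightarrow> (\<exists>y. H = Fg y)"

definition maximal_based_filter :: "'a::lattice \<Rightarrow> 'a fil \<Rightarrow> bool" where
  "maximal_based_filter x H \<longleftrightarrow> Fg x \<prec> H"

definition atomic_mbf :: "'a::lattice \<Rightarrow> 'a fil \<Rightarrow> bool" where
  "atomic_mbf x H \<longleftrightarrow> maximal_based_filter x H \<and> principal_fil H"

definition quasi_atomic_mbf :: "'a::lattice \<Rightarrow> 'a fil \<Rightarrow> bool" where
  "quasi_atomic_mbf x H \<longleftrightarrow> maximal_based_filter x H \<and> \<not> principal_fil H \<and>
     (\<exists>y\<in>elems H. \<forall>z. x < z \<and> z \<le> y \<longrightarrow> z \<in> elems H)"

definition atomic_covering :: "'a::lattice fil \<Rightarrow> 'a fil \<Rightarrow> bool" where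
  "atomic_covering F G \<longleftrightarrow> F \<prec> G \<and> (\<exists>x H. atomic_mbf x H \<and> (F, G) \<approx> (Fg x, H))"

definition quasi_atomic_covering :: "'a::lattice fil \<Rightarrow> 'a fil \<Rightarrow> bool" where
  "quasi_atomic_covering F G \<longleftrightarrow> F \<prec> G \<and> (\<exists>x H. quasi_atomic_mbf x H \<and> (F, G) \<approx> (Fg x, H))"

definition anomalous_covering :: "'a::lattice fil \<Rightarrow> 'a fil \<Rightarrow> bool" where
  "anomalous_covering F G \<longleftrightarrow> F \<prec> G \<and> \<not> atomic_covering F G \<and> \<not> quasi_atomic_covering F G"

end

theory Submission
  imports Defs
begin

text \<open>
  Every \<open>z \<in> F - G\<close> gives a maximal based filter \<open>Fg z \<prec> Fg z \<squnion> G\<close> above \<open>F \<prec> G\<close>, and these transpose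
  upwards into each other as \<open>z\<close> grows.  The joins along a chain \<open>C\<close> in \<open>F - G\<close> are \<open>Fg (\<Squnion>C)\<close>
  and \<open>Fg (\<Squnion>C) \<squnion> G\<close>, so upper regularity forces \<open>\<Squnion>C \<notin> G\<close>.  Zorn's lemma then yields a maximal
  \<open>m \<in> F - G\<close>; everything strictly above \<open>m\<close> lies in \<open>G\<close>, which makes the maximal based filter at
  \<open>m\<close> atomic or quasi-atomic.
\<close>

text \<open>By modularity any \<open>t\<close> between \<open>z\<close> and \<open>w\<close> equals
  \<open>sup z (inf y t)\<close>, so it is determined by \<open>inf y t\<close>. This lies between
  \<open>x\<close> and \<open>y\<close>, hence is one of the two, and \<open>t\<close> is
  \<open>z\<close> or \<open>w\<close> accordingly.\<close>

lemma transposes_up_covered_by: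
  fixes x y z w :: "'a::modular_lattice"
  assumes "x \<prec> y" and "(x, y) \<nearrow> (z, w)"
  shows "z \<prec> w"
proof -
  have xy: "x < y" and between: "\<not> (x < t \<and> t < y)" for t
    using assms(1) by (auto simp: covered_by_def)
  have eqs: "inf y z = x" "sup y z = w" "z \<le> w"
    using assms(2) by (auto simp: transposes_up_def)
  have "z \<noteq> w"
    using eqs(1,2) xy by (metis inf.orderE less_irrefl sup.cobounded1)
  moreover have False if t: "z < t" "t < w" for t
  proof -
    have t_eq: "sup z (inf y t) = t"
      using modular[of z t y] t eqs(2) by (simp add: sup_commute inf_absorb2)
    have "x \<le> inf y t"
      using eqs(1) t(1) by (metis inf_mono less_imp_le order_refl)
    then consider "inf y t = x" | "inf y t = y"
      using between[of "inf y t"] by (metis inf_le1 order_le_less)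
    then show False
    proof cases
      case 1
      then have "t = z" using t_eq eqs(1) by (metis inf_le2 sup_absorb1)
      then show False using t(1) by simp
    next
      case 2
      then have "t = w" using t_eq eqs(2) by (simp add: sup_commute)
      then show False using t(2) by simp
    qed
  qed
  ultimately show ?thesis
    using eqs(3) by (auto simp: covered_by_def)
qed

lemma mem_elems_iff_le_Fg: "z \<in> elems F \<longleftrightarrow> F \<le> Fg z"
  by transfer (auto dest: lattice_filter_up)

lemma mem_elems_Fg_iff: "z \<in> elems (Fg x) \<longleftrightarrow> x \<le> z"
  by transfer simp

lemma Fg_le_Fg_iff: "Fg x \<le> Fg z \<longleftrightarrow> x \<le> z"
  by (simp add: mem_elems_iff_le_Fg [symmetric] mem_elems_Fg_iff)

lemma elems_sup_fil: "elems (sup F G) = elems F \<inter> elems G"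
  by transfer simp

text \<open>Joins of filters are intersections, so both sides consist of the upper bounds of
  \<open>C\<close>.\<close>

lemma SUP_Fg: "(SUP z\<in>C. Fg z) = Fg (Sup C)"
proof -
  have "elems (SUP z\<in>C. Fg z) = elems (Fg (Sup C))"
    by transfer (auto simp: Sup_le_iff)
  then show ?thesis by (simp add: elems_inject)
qed

text \<open>Since \<open>z\<close> is not in \<open>G\<close>, the filter
  \<open>inf G (Fg z)\<close> is strictly below \<open>G\<close>; it is also above \<open>F\<close>,
  so the covering forces it to be \<open>F\<close>.\<close>

lemma transposes_up_Fg:
  fixes F G :: "'a::lattice fil"
  assumes "F \<prec> G" and "z \<in> elems F" and "z \<notin> elems G"
  shows "(F, G) \<nearrow> (Fg z, sup (Fg z) G)"
proof -
  have le: "F \<le> G" "F \<le> Fg z" "\<not> G \<le> Fg z"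
    using assms by (auto simp: covered_by_def mem_elems_iff_le_Fg)
  then have "F \<le> inf G (Fg z)" "inf G (Fg z) < G"
    by (auto simp: less_le_not_le)
  then have "inf G (Fg z) = F"
    using assms(1) by (auto simp: covered_by_def order_le_less)
  then show ?thesis
    using le by (simp add: transposes_up_def sup_commute)
qed

text \<open>The modular law turns \<open>inf (sup a c) b\<close> into
  \<open>sup a (inf c b)\<close>, which is \<open>a\<close>. With \<open>c\<close> taken as
  \<open>G\<close>, this compares the coverings at two members of a chain.\<close>

lemma transposes_up_join_right:
  fixes a b c :: "'a::modular_lattice"
  assumes "a \<le> b" and "inf c b \<le> a"
  shows "(a, sup a c) \<nearrow> (b, sup b c)"
proof -
  have "inf (sup a c) b = a"
    using modular[of a b c] assms by (simp add: sup_absorb1)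
  moreover have "sup (sup a c) b = sup b c"
    using assms(1) by (metis sup_absorb1 sup_assoc sup_commute)
  ultimately show ?thesis by (simp add: transposes_up_def)
qed

lemma projective_if_transposes_up:
  assumes "p \<nearrow> q"
  shows "p \<approx> q" and "q \<approx> p"
  using assms by (auto simp: projective_def symclp_def)

theorem corollary24:
  fixes F G :: "'a::complete_modular_lattice fil"
  assumes "F \<prec> G"
    and "anomalous_covering F G"
  shows "\<not> upper_regular F G"
proof
  assume reg: "upper_regular F G"
  define A where "A = elems F - elems G"
  have up: "(F, G) \<nearrow> (Fg z, sup (Fg z) G)" if "z \<in> A" for z
    using transposes_up_Fg[OF assms(1)] that by (simp add: A_def)
  have cov: "Fg z \<prec> sup (Fg z) G" if "z \<in> A" for z
    using transposes_up_covered_by[OF assms(1) up[OF that]] .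
  have "\<not> G \<le> F" using assms(1) by (auto simp: covered_by_def less_le_not_le)
  then obtain a where a: "a \<in> A"
    unfolding A_def by transfer blast
  have Sup_mem: "Sup C \<in> A" if C: "C \<noteq> {}" "C \<subseteq> A" "\<And>y z. y \<in> C \<Longrightarrow> z \<in> C \<Longrightarrow> y \<le> z \<or> z \<le> y" for C
  proof -
    define r where "r = {(y, z). y \<in> C \<and> z \<in> C \<and> y \<le> z}"
    have "linear_order_on C r"
      using C(3) unfolding r_def linear_order_on_def partial_order_on_def preorder_on_def
      by (auto simp: refl_on_def trans_def antisym_def total_on_def)
    moreover have "(Fg y, sup (Fg y) G) \<nearrow> (Fg z, sup (Fg z) G)"
      if "y \<in> C" "z \<in> C" "(y, z) \<in> r" for y z
    proof (rule transposes_up_join_right)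
      show "Fg y \<le> Fg z" using that by (simp add: r_def Fg_le_Fg_iff)
      have "inf G (Fg z) = F" using up[of z] that C(2) by (auto simp: transposes_up_def)
      also have "F \<le> Fg y" using that C(2) by (auto simp: A_def mem_elems_iff_le_Fg)
      finally show "inf G (Fg z) \<le> Fg y" .
    qed
    ultimately have "(SUP z\<in>C. Fg z) \<prec> (SUP z\<in>C. sup (Fg z) G)"
      using cov projective_if_transposes_up(2)[OF up] C(1,2)
      by (intro upper_regularD[OF reg, where r = r]) auto
    \<comment> \<open>The constant \<open>G\<close> can be pulled out of the join because
      \<open>C\<close> is nonempty.\<close>
    moreover have "(SUP z\<in>C. sup (Fg z) G) = sup (Fg (Sup C)) G"
      using C(1) by (simp add: SUP_sup_distrib [symmetric] SUP_Fg)
    ultimately have "Fg (Sup C) < sup (Fg (Sup C)) G"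
      by (simp add: covered_by_def SUP_Fg)
    \<comment> \<open>Otherwise \<open>G \<le> Fg (Sup C)\<close>, and the two joins would
      coincide.\<close>
    then have "Sup C \<notin> elems G"
      by (auto simp: mem_elems_iff_le_Fg sup_absorb1)
    moreover obtain z where "z \<in> C" using C(1) by blast
    then have "Fg z \<le> Fg (Sup C)" "F \<le> Fg z"
      using C(2) by (auto simp: Fg_le_Fg_iff Sup_upper A_def mem_elems_iff_le_Fg)
    then have "Sup C \<in> elems F"
      by (auto simp: mem_elems_iff_le_Fg)
    ultimately show ?thesis by (simp add: A_def)
  qed
  have "\<exists>m\<in>A. \<forall>z\<in>A. m \<le> z \<longrightarrow> z = m"
  proof (rule predicate_Zorn)
    show "partial_order_on A (relation_of (\<le>) A)"
      by (rule partial_order_on_relation_ofI) auto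
    fix C assume "C \<in> Chains (relation_of (\<le>) A)"
    then have "C \<subseteq> A" "\<And>y z. y \<in> C \<Longrightarrow> z \<in> C \<Longrightarrow> y \<le> z \<or> z \<le> y"
      by (auto simp: Chains_def relation_of_def)
    \<comment> \<open>The empty chain is bounded by \<open>a\<close>, any other chain by its
      supremum.\<close>
    then show "\<exists>u\<in>A. \<forall>z\<in>C. z \<le> u"
      using Sup_mem[of C] a by (cases "C = {}") (auto intro: Sup_upper)
  qed
  then obtain m where m: "m \<in> A" and max: "\<And>z. z \<in> A \<Longrightarrow> m \<le> z \<Longrightarrow> z = m"
    by blast
  define H where "H = sup (Fg m) G"
  have above: "z \<in> elems H" if "m < z" for z
  proof -
    have "z \<in> elems F"
      using m that by (metis A_def DiffD1 Fg_le_Fg_iff less_imp_le mem_elems_iff_le_Fg order_trans)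
    then have "z \<in> elems G" using max[of z] that by (auto simp: A_def less_le)
    then show ?thesis using that by (simp add: H_def elems_sup_fil mem_elems_Fg_iff)
  qed
  have "maximal_based_filter m H"
    using cov[OF m] by (simp add: maximal_based_filter_def H_def)
  \<comment> \<open>By \<open>above\<close>, any member of \<open>H\<close> is a witness for
    quasi-atomicity when \<open>H\<close> is not principal.\<close>
  moreover obtain y where "y \<in> elems H"
    using elems[of H] lattice_filter_ex by blast
  ultimately have "atomic_mbf m H \<or> quasi_atomic_mbf m H"
    using above by (auto simp: atomic_mbf_def quasi_atomic_mbf_def)
  moreover have "(F, G) \<approx> (Fg m, H)"
    using projective_if_transposes_up(1)[OF up[OF m]] by (simp add: H_def)
  ultimately show False
    using assms by (auto simp: anomalous_covering_def atomic_covering_def quasi_atomic_covering_def)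
qed

end
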